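(* Let $\Omega\subset\mathbb{R}^4$ be open, let $d^{(k)}$ be the exterior derivative on $k$-forms and let $[\varphi]^{(k)}$ denote the proxy of a $k$-form $\varphi$. The following identities hold: \begin{align*} [d^{(0)}\varphi]^{(1)}&=\mathrm{grad}\,([\varphi]^{(0)}),&&\varphi\in\mathcal{D}'(\Omega,\Lambda^0),\\ [d^{(1)}\varphi]^{(2)}&=\mathrm{Curl}\,([\varphi]^{(1)}),&&\varphi\in\mathcal{D}'(\Omega,\Lambda^1),\\ [d^{(2)}\varphi]^{(3)}&=\mathrm{Div}\,([\varphi]^{(2)}),&&\varphi\in\mathcal{D}'(\Omega,\Lambda^2),\\ [d^{(3)}\varphi]^{(4)}&=\mathrm{div}\,([\varphi]^{(3)}),&&\varphi\in\mathcal{D}'(\Omega,\Lambda^3). \end{align*}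
   Context: $\Lambda^k$ is the space of exterior $k$-forms on $\mathbb{R}^4$; $\mathcal{D}'(\Omega,\Lambda^k)$ is the space of $k$-forms $\varphi=\sum_{1\le i_1<\cdots<i_k\le4}\varphi_{i_1\cdots i_k}\,dx^{i_1}\wedge\cdots\wedge dx^{i_k}$ whose components are distributions on $\Omega$ (and similarly for other value spaces). The exterior derivative is $d\varphi=\sum_{i_1<\cdots<i_k}\sum_{m=1}^4\partial_m\varphi_{i_1\cdots i_k}\,dx^m\wedge dx^{i_1}\wedge\cdots\wedge dx^{i_k}$. Let $\varepsilon_{ijkl}$ be the Levi-Civita permutation symbol on $\{1,2,3,4\}$ and $\mathbb{K}$ the space of $4\times4$ skew-symmetric matrices. The proxy $[\varphi]^{(k)}$ is: $[\varphi]^{(0)}=\varphi$; $[\varphi]^{(1)}=(\varphi_1,\varphi_2,\varphi_3,\varphi_4)^\top$; $[\varphi]^{(2)}$ is the $\mathbb{K}$-valued object with entries $[\varphi]^{(2)}_{ij}=\sum_{1\le k<l\le4}\varepsilon_{ijkl}\varphi_{kl}$; $[\varphi]^{(3)}$ is the vector with $[\varphi]^{(3)}_i=\sum_{1\le j<k<l\le4}\varepsilon_{ijkl}\varphi_{jkl}$; $[\varphi]^{(4)}=\varphi_{1234}$. The differential operators (in the sense of distributions) are: $[\mathrm{grad}\,u]_i=\partial_iu$ for scalar $u$; $[\mathrm{Curl}\,w]_{ij}=\sum_{k,l=1}^4\varepsilon_{ijkl}\partial_kw_l$ for $w$ with values in $\mathbb{R}^4$ (result in $\mathbb{K}$); $[\mathrm{Div}\,\kappa]_i=\sum_{j=1}^4\partial_j\kappa_{ij}$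 for $\kappa$ with values in $\mathbb{K}$ (result in $\mathbb{R}^4$); $\mathrm{div}\,v=\sum_{i=1}^4\partial_iv_i$ for $v$ with values in $\mathbb{R}^4$. *)

theory Defs
  imports "HOL-Analysis.Analysis"
begin

section \<open>Distributions\<close>

definition partial_deriv :: "4 \<Rightarrow> (real^4 \<Rightarrow> real) \<Rightarrow> real^4 \<Rightarrow> real" where
  "partial_deriv m f = (\<lambda>x. frechet_derivative f (at x) (axis m 1))"

abbreviation iterated_partial :: "4 list \<Rightarrow> (real^4 \<Rightarrow> real) \<Rightarrow> real^4 \<Rightarrow> real" where
  "iterated_partial \<alpha> f \<equiv> foldr partial_deriv \<alpha> f"

definition smooth :: "(real^4 \<Rightarrow> real) \<Rightarrow> bool" where
  "smooth f \<longleftrightarrow> (\<forall>\<alpha> x. iterated_partial \<alpha> f differentiable (at x))"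

definition supp :: "(real^4 \<Rightarrow> real) \<Rightarrow> (real^4) set" where
  "supp f = closure {x. f x \<noteq> 0}"

text \<open>The space of smooth functions with compact support in \<open>\<Omega>\<close>; its elements are taken on all of
  \<open>\<real>\<^sup>4\<close>, that is, extended by zero.\<close>

definition test_functions :: "(real^4) set \<Rightarrow> (real^4 \<Rightarrow> real) set" where
  "test_functions \<Omega> = {f. smooth f \<and> compact (supp f) \<and> supp f \<subseteq> \<Omega>}"

type_synonym functional = "(real^4 \<Rightarrow> real) \<Rightarrow> real"

text \<open>A distribution is a linear functional on test functions that satisfies, on every compact set,
  an estimate by finitely many of the standard seminorms. It is given the value \<open>0\<close> on functions that are
  not test functions, so that equality of distributions is equality in HOL.\<close>

definition distributions :: "(real^4) set \<Rightarrow> functional set" where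
  "distributions \<Omega> = {T.
     (\<forall>f. f \<notin> test_functions \<Omega> \<longrightarrow> T f = 0) \<and>
     (\<forall>f\<in>test_functions \<Omega>. \<forall>g\<in>test_functions \<Omega>. \<forall>a b.
        T (\<lambda>x. a * f x + b * g x) = a * T f + b * T g) \<and>
     (\<forall>K. compact K \<and> K \<subseteq> \<Omega> \<longrightarrow> (\<exists>C N. \<forall>f\<in>test_functions \<Omega>. supp f \<subseteq> K \<longrightarrow>
        \<bar>T f\<bar> \<le> C * (\<Sum>\<alpha> | length \<alpha> \<le> N. SUP x. \<bar>iterated_partial \<alpha> f x\<bar>)))}"

definition dist_partial :: "(real^4) set \<Rightarrow> 4 \<Rightarrow> functional \<Rightarrow> functional" where
  "dist_partial \<Omega> m T = (\<lambda>f. if f \<in> test_functions \<Omega> then - T (partial_deriv m f) else 0)"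


section \<open>Exterior forms with distributional components\<close>

text \<open>In the type \<open>4\<close> the numeral \<open>4\<close> is equal to \<open>0\<close>, so the library order on this type is
  \<open>4 < 1 < 2 < 3\<close>. The order \<open>1 < 2 < 3 < 4\<close> is therefore given by an explicit list.\<close>

definition increasing_indices :: "nat \<Rightarrow> 4 list set" where
  "increasing_indices k = {I \<in> set (subseqs [1, 2, 3, 4]). length I = k}"

text \<open>The exterior \<open>k\<close>-form \<open>dx\<^bsup>i\<^sub>1\<^esup> \<and> \<dots> \<and> dx\<^bsup>i\<^sub>k\<^esup>\<close> for arbitrary indices, as an alternating multilinear map:
  its value at \<open>v\<^sub>1, \<dots>, v\<^sub>k\<close> is the determinant of the matrix of the numbers \<open>dx\<^bsup>i\<^sub>a\<^esup>(v\<^sub>b)\<close>.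
  Maps of \<open>k\<close> vectors are maps on lists, with value \<open>0\<close> on lists of any other length.\<close>

definition wedge_dx :: "4 list \<Rightarrow> (real^4) list \<Rightarrow> real" where
  "wedge_dx I vs =
     (if length vs = length I
      then \<Sum>p | p permutes {..<length I}.
             of_int (sign p) * (\<Prod>a<length I. (vs ! p a) $ (I ! a))
      else 0)"

text \<open>A form with distributional components, as a map from test functions to exterior forms.\<close>

type_synonym form_functional = "(real^4 \<Rightarrow> real) \<Rightarrow> (real^4) list \<Rightarrow> real"

definition form_distributions :: "(real^4) set \<Rightarrow> nat \<Rightarrow> form_functional set" where
  "form_distributions \<Omega> k = {\<phi>. \<exists>c. (\<forall>I\<in>increasing_indices k. c I \<in> distributions \<Omega>) \<and>
     \<phi> = (\<lambda>f vs. \<Sum>I\<in>increasing_indices k. c I f * wedge_dx I vs)}"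

text \<open>The component of a form at \<open>dx\<^bsup>i\<^sub>1\<^esup> \<and> \<dots> \<and> dx\<^bsup>i\<^sub>k\<^esup>\<close> is its value at the standard basis
  vectors \<open>e\<^sub>i\<^sub>1, \<dots>, e\<^sub>i\<^sub>k\<close>; see \<open>component_sum_wedge_dx\<close> below.\<close>

definition component :: "form_functional \<Rightarrow> 4 list \<Rightarrow> functional" where
  "component \<phi> I = (\<lambda>f. \<phi> f (map (\<lambda>i. axis i 1) I))"

definition ext_deriv :: "(real^4) set \<Rightarrow> nat \<Rightarrow> form_functional \<Rightarrow> form_functional" where
  "ext_deriv \<Omega> k \<phi> = (\<lambda>f vs. \<Sum>I\<in>increasing_indices k. \<Sum>m\<in>UNIV.
     dist_partial \<Omega> m (component \<phi> I) f * wedge_dx (m # I) vs)"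

lemma wedge_dx_basis:
  assumes "I \<in> increasing_indices k" "J \<in> increasing_indices k"
  shows "wedge_dx I (map (\<lambda>i. axis i 1) J) = (if I = J then 1 else 0)"
proof -
  have dist: "distinct [1, 2, 3, 4 :: 4]" by simp
  have len: "length I = k" "length J = k"
    and sub: "I \<in> set (subseqs [1, 2, 3, 4])" "J \<in> set (subseqs [1, 2, 3, 4])"
    using assms unfolding increasing_indices_def by blast+
  have dJ: "distinct J" by (rule subseqs_distinctD[OF sub(2) dist])
  have unique: "I = J \<and> p = id"
    if p: "p permutes {..<k}" and eq: "\<forall>a<k. J ! p a = I ! a" for p
  proof -
    have "set I = (\<lambda>a. J ! a) ` p ` {..<k}"
      using eq len by (force simp: set_conv_nth image_iff)
    also have "\<dots> = set J"
      using len by (auto simp: permutes_image[OF p] set_conv_nth)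
    finally have IJ: "I = J"
      using distinct_set_subseqs[OF dist] sub unfolding distinct_map by (blast dest: inj_onD)
    have "p a = a" for a
    proof (cases "a < k")
      case True
      then have "p a < k" using permutes_in_image[OF p, of a] by simp
      then show ?thesis using True eq IJ dJ len by (metis nth_eq_iff_index_eq)
    qed (use p in \<open>auto simp: permutes_def\<close>)
    then show ?thesis using IJ by auto
  qed
  have prod: "(\<Prod>a<k. (map (\<lambda>i. axis i 1) J ! p a) $ (I ! a)) = (if I = J \<and> p = id then 1 else 0 :: real)"
    if p: "p permutes {..<k}" for p
  proof -
    have "(\<Prod>a<k. (map (\<lambda>i. axis i 1) J ! p a) $ (I ! a)) =
        (\<Prod>a<k. if J ! p a = I ! a then 1 else 0 :: real)"
    proof (rule prod.cong)
      fix a assume "a \<in> {..<k}"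
      then have "p a < k" using permutes_in_image[OF p, of a] by simp
      then show "(map (\<lambda>i. axis i 1) J ! p a) $ (I ! a) = (if J ! p a = I ! a then 1 else 0 :: real)"
        using len by (simp add: axis_def)
    qed simp
    also have "\<dots> = (if \<forall>a<k. J ! p a = I ! a then 1 else 0)"
      by (auto intro!: prod.neutral)
    finally show ?thesis using unique[OF p] by auto
  qed
  have "wedge_dx I (map (\<lambda>i. axis i 1) J) =
      (\<Sum>p | p permutes {..<k}. of_int (sign p) * (if I = J \<and> p = id then 1 else 0))"
    unfolding wedge_dx_def using len prod by (auto intro!: sum.cong)
  also have "\<dots> = (\<Sum>p | p permutes {..<k}. if p = id then (if I = J then 1 else 0) else 0)"
    by (auto intro!: sum.cong)
  also have "\<dots> = (if I = J then 1 else 0)"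
    by (simp add: sum.delta finite_permutations permutes_id)
  finally show ?thesis .
qed

lemma component_sum_wedge_dx:
  assumes "J \<in> increasing_indices k"
  shows "component (\<lambda>f vs. \<Sum>I\<in>increasing_indices k. c I f * wedge_dx I vs) J = c J"
proof -
  have "finite (increasing_indices k)" by (simp add: increasing_indices_def)
  then show ?thesis
    using assms by (simp add: component_def wedge_dx_basis if_distrib sum.delta cong: if_cong)
qed


section \<open>Proxies and differential operators\<close>

definition levi_civita :: "4 \<Rightarrow> 4 \<Rightarrow> 4 \<Rightarrow> 4 \<Rightarrow> real" where
  "levi_civita i j k l =
     (let p = id(1 := i, 2 := j, 3 := k, 4 := l) in if bij p then of_int (sign p) else 0)"

definition proxy0 :: "form_functional \<Rightarrow> functional" where
  "proxy0 \<phi> = component \<phi> []"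

definition proxy1 :: "form_functional \<Rightarrow> functional^4" where
  "proxy1 \<phi> = (\<chi> i. component \<phi> [i])"

definition proxy2 :: "form_functional \<Rightarrow> functional^4^4" where
  "proxy2 \<phi> = (\<chi> i. \<chi> j. (\<lambda>f. \<Sum>I\<in>increasing_indices 2.
     levi_civita i j (I ! 0) (I ! 1) * component \<phi> I f))"

definition proxy3 :: "form_functional \<Rightarrow> functional^4" where
  "proxy3 \<phi> = (\<chi> i. (\<lambda>f. \<Sum>I\<in>increasing_indices 3.
     levi_civita i (I ! 0) (I ! 1) (I ! 2) * component \<phi> I f))"

definition proxy4 :: "form_functional \<Rightarrow> functional" where
  "proxy4 \<phi> = component \<phi> [1, 2, 3, 4]"

definition grad :: "(real^4) set \<Rightarrow> functional \<Rightarrow> functional^4" where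
  "grad \<Omega> u = (\<chi> i. dist_partial \<Omega> i u)"

definition Curl :: "(real^4) set \<Rightarrow> functional^4 \<Rightarrow> functional^4^4" where
  "Curl \<Omega> w = (\<chi> i. \<chi> j. (\<lambda>f. \<Sum>k\<in>UNIV. \<Sum>l\<in>UNIV. levi_civita i j k l * dist_partial \<Omega> k (w $ l) f))"

definition Div :: "(real^4) set \<Rightarrow> functional^4^4 \<Rightarrow> functional^4" where
  "Div \<Omega> \<kappa> = (\<chi> i. (\<lambda>f. \<Sum>j\<in>UNIV. dist_partial \<Omega> j (\<kappa> $ i $ j) f))"

definition divergence :: "(real^4) set \<Rightarrow> functional^4 \<Rightarrow> functional" where
  "divergence \<Omega> v = (\<lambda>f. \<Sum>i\<in>UNIV. dist_partial \<Omega> i (v $ i) f)"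

end

theory Submission
  imports Defs
begin

text \<open>Both the forms \<open>dx\<^bsup>i\<^sub>1\<^esup> \<and> \<dots> \<and> dx\<^bsup>i\<^sub>k\<^esup>\<close> and the Levi-Civita symbol change sign when two adjacent indices
  are swapped. Sorting the indices therefore expresses both sides of each identity through the same
  partial derivatives of the components of \<open>\<phi>\<close>, and the signs agree.\<close>

text \<open>This is the effect of a row permutation on a determinant. In the Leibniz sum, p is
  replaced by \<open>p \<circ> q\<close>, which contributes \<open>sign q\<close>; reindexing the
  product along q then recovers the factors belonging to I.\<close>

lemma wedge_dx_permute_list:
  assumes q: "q permutes {..<length I}"
  shows "wedge_dx (permute_list q I) vs = of_int (sign q) * wedge_dx I vs"
proof (cases "length vs = length I")
  case True
  let ?n = "length I"
  have q_inv: "inv q permutes {..<?n}" by (rule permutes_inv[OF q])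
  have "(\<Sum>p | p permutes {..<?n}. of_int (sign p) * (\<Prod>a<?n. vs ! p a $ (permute_list q I ! a)))
      = (\<Sum>p | p permutes {..<?n}. of_int (sign (p \<circ> q)) *
          (\<Prod>a<?n. vs ! (p \<circ> q) a $ (permute_list q I ! a)))"
    by (rule sum.reindex_bij_witness[where i = "\<lambda>p. p \<circ> q" and j = "\<lambda>p. p \<circ> inv q"])
      (auto simp: comp_assoc permutes_inv_o[OF q] intro: permutes_compose[OF q] permutes_compose[OF q_inv])
  also have "\<dots> = (\<Sum>p | p permutes {..<?n}. of_int (sign q) *
      (of_int (sign p) * (\<Prod>a<?n. vs ! p a $ (I ! a))))"
  proof (rule sum.cong)
    fix p assume "p \<in> {p. p permutes {..<?n}}"
    then have "sign (p \<circ> q) = sign p * sign q"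
      using q by (metis finite_lessThan mem_Collect_eq permutation_permutes sign_compose)
    moreover have "(\<Prod>a<?n. vs ! (p \<circ> q) a $ (permute_list q I ! a)) = (\<Prod>a<?n. vs ! p (q a) $ (I ! q a))"
      by (rule prod.cong) (auto simp: permute_list_nth[OF q])
    moreover have "\<dots> = (\<Prod>a<?n. vs ! p a $ (I ! a))"
      using prod.permute[OF q, of "\<lambda>a. vs ! p a $ (I ! a)"] by (simp add: comp_def)
    ultimately show "of_int (sign (p \<circ> q)) * (\<Prod>a<?n. vs ! (p \<circ> q) a $ (permute_list q I ! a)) =
      of_int (sign q) * (of_int (sign p) * (\<Prod>a<?n. vs ! p a $ (I ! a)))"
      by simp
  qed simp
  finally show ?thesis
    using True by (simp add: wedge_dx_def sum_distrib_left)
qed (simp add: wedge_dx_def)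

lemma wedge_dx_swap:
  "wedge_dx (xs @ a # b # ys) vs = - wedge_dx (xs @ b # a # ys) vs"
proof -
  let ?n = "length xs" and ?I = "xs @ b # a # ys"
  let ?q = "Transposition.transpose ?n (Suc ?n)"
  have q: "?q permutes {..<length ?I}"
    by (rule permutes_swap_id) auto
  have "permute_list ?q ?I = xs @ a # b # ys"
  proof (rule nth_equalityI)
    fix i assume "i < length (permute_list ?q ?I)"
    then have "permute_list ?q ?I ! i = ?I ! ?q i" by (simp add: permute_list_nth[OF q])
    moreover consider "i < ?n" | "i = ?n" | "i = Suc ?n" | "i > Suc ?n" by linarith
    then have "?I ! ?q i = (xs @ a # b # ys) ! i"
      by cases (auto simp: nth_append nth_Cons' Transposition.transpose_def)
    ultimately show "permute_list ?q ?I ! i = (xs @ a # b # ys) ! i" by simp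
  qed simp
  then show ?thesis
    using wedge_dx_permute_list[OF q, of vs] by (simp add: sign_swap_id)
qed

lemma wedge_dx_repeat: "wedge_dx (xs @ a # a # ys) vs = 0"
  using wedge_dx_swap[of xs a a ys vs] by simp

lemma levi_civita_swap:
  "levi_civita j i k l = - levi_civita i j k l"
  "levi_civita i k j l = - levi_civita i j k l"
  "levi_civita i j l k = - levi_civita i j k l"
proof -
  \<comment> \<open>The symbol as a function of the map p: exchanging two arguments composes p on
    the right with a transposition.\<close>
  define s :: "(4 \<Rightarrow> 4) \<Rightarrow> real" where "s p = (if bij p then of_int (sign p) else 0)" for p
  have s_swap: "s (p \<circ> Transposition.transpose a b) = - s p" if "a \<noteq> b" for p a b
  proof (cases "bij p")
    case True
    then have "permutation p" by (simp add: permutation)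
    then show ?thesis
      using True that
      by (simp add: s_def sign_compose permutation_swap_id sign_swap_id bij_comp)
  next
    \<comment> \<open>Both sides are 0: a transposition is its own inverse, so composing with it
      cannot turn a non-bijection into a bijection.\<close>
    case False
    have "\<not> bij (p \<circ> Transposition.transpose a b)"
    proof
      assume "bij (p \<circ> Transposition.transpose a b)"
      from bij_comp[OF bij_transpose[of a b] this] False show False by (simp add: comp_assoc)
    qed
    with False show ?thesis by (simp add: s_def)
  qed
  have s_levi: "levi_civita i j k l = s (id(1 := i, 2 := j, 3 := k, 4 := l))" for i j k l
    by (simp only: levi_civita_def s_def Let_def)
  let ?p = "id(1 := i, 2 := j, 3 := k, 4 := l)"
  have "id(1 := j, 2 := i, 3 := k, 4 := l) = ?p \<circ> Transposition.transpose 1 2"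
    "id(1 := i, 2 := k, 3 := j, 4 := l) = ?p \<circ> Transposition.transpose 2 3"
    "id(1 := i, 2 := j, 3 := l, 4 := k) = ?p \<circ> Transposition.transpose 3 4"
    unfolding fun_eq_iff forall_4 by (simp_all add: Transposition.transpose_def)
  then show "levi_civita j i k l = - levi_civita i j k l"
    "levi_civita i k j l = - levi_civita i j k l"
    "levi_civita i j l k = - levi_civita i j k l"
    unfolding s_levi
    using s_swap[of 1 2 ?p] s_swap[of 2 3 ?p] s_swap[of 3 4 ?p] by (simp_all del: fun_upd_apply)
qed

lemma levi_civita_repeat:
  "levi_civita i i k l = 0" "levi_civita i j j l = 0" "levi_civita i j k k = 0"
  using levi_civita_swap(1)[of i i k l] levi_civita_swap(2)[of i j j l] levi_civita_swap(3)[of i j k k]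
  by simp_all

lemma levi_civita_1234: "levi_civita 1 2 3 4 = 1"
proof -
  have "id(1 := 1, 2 := 2, 3 := 3, 4 := 4) = (id :: 4 \<Rightarrow> 4)" by (auto simp: fun_eq_iff)
  then show ?thesis by (simp add: levi_civita_def)
qed

text \<open>The degree 1 appears as \<open>Suc 0\<close>, the form to which the simplifier
  normalizes it.\<close>

lemma increasing_indices_simps:
  "increasing_indices 0 = {[]}"
  "increasing_indices (Suc 0) = {[1], [2], [3], [4]}"
  "increasing_indices 2 = {[1,2], [1,3], [1,4], [2,3], [2,4], [3,4]}"
  "increasing_indices 3 = {[1,2,3], [1,2,4], [1,3,4], [2,3,4]}"
proof -
  have "increasing_indices k = set (filter (\<lambda>I. length I = k) (subseqs [1, 2, 3, 4]))" for k
    by (auto simp: increasing_indices_def simp del: subseqs.simps)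
  then show "increasing_indices 0 = {[]}"
    "increasing_indices (Suc 0) = {[1], [2], [3], [4]}"
    "increasing_indices 2 = {[1,2], [1,3], [1,4], [2,3], [2,4], [3,4]}"
    "increasing_indices 3 = {[1,2,3], [1,2,4], [1,3,4], [2,3,4]}"
    by (simp_all add: Let_def)
qed

text \<open>For increasing J, this is the coefficient of \<open>dx^J\<close> in \<open>dx^I\<close>.
  A separate constant keeps J visible to rewriting, where \<open>map\<close> on an explicit list
  would be evaluated.\<close>

definition wedge_coeff :: "4 list \<Rightarrow> 4 list \<Rightarrow> real" where
  "wedge_coeff I J = wedge_dx I (map (\<lambda>i. axis i 1) J)"

text \<open>The degree is written as \<open>length J\<close> so that the left-hand side determines
  every variable of the rewrite rule.\<close>

lemma wedge_coeff_increasing: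
  assumes "I \<in> increasing_indices (length J)" "J \<in> increasing_indices (length J)"
  shows "wedge_coeff I J = (if I = J then 1 else 0)"
  unfolding wedge_coeff_def using assms by (rule wedge_dx_basis)

text \<open>Simplifying the length of an explicit list yields a successor term and not a numeral.\<close>

lemma increasing_indices_mem:
  "[1, 2] \<in> increasing_indices (Suc (Suc 0))" "[1, 3] \<in> increasing_indices (Suc (Suc 0))"
  "[1, 4] \<in> increasing_indices (Suc (Suc 0))" "[2, 3] \<in> increasing_indices (Suc (Suc 0))"
  "[2, 4] \<in> increasing_indices (Suc (Suc 0))" "[3, 4] \<in> increasing_indices (Suc (Suc 0))"
  "[1, 2, 3] \<in> increasing_indices (Suc (Suc (Suc 0)))"
  "[1, 2, 4] \<in> increasing_indices (Suc (Suc (Suc 0)))"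
  "[1, 3, 4] \<in> increasing_indices (Suc (Suc (Suc 0)))"
  "[2, 3, 4] \<in> increasing_indices (Suc (Suc (Suc 0)))"
  "[1, 2, 3, 4] \<in> increasing_indices (Suc (Suc (Suc (Suc 0))))"
  by (simp_all add: increasing_indices_def Let_def)

lemma component_ext_deriv:
  "component (ext_deriv \<Omega> k \<phi>) J = (\<lambda>f. \<Sum>I\<in>increasing_indices k. \<Sum>m\<in>UNIV.
     dist_partial \<Omega> m (component \<phi> I) f * wedge_coeff (m # I) J)"
  by (simp add: component_def ext_deriv_def wedge_coeff_def)

text \<open>Once the Levi-Civita values are inserted, every entry of \<open>proxy2\<close> and
  \<open>proxy3\<close> is zero or a single component up to sign.\<close>

lemma dist_partial_zero: "dist_partial \<Omega> m (\<lambda>f. 0) f = 0"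
  and dist_partial_minus: "dist_partial \<Omega> m (\<lambda>f. - T f) f = - dist_partial \<Omega> m T f"
  by (simp_all add: dist_partial_def)

text \<open>Pairs out of order for \<open>1 < 2 < 3 < 4\<close>. As a side condition, membership orients the swap rules,
  so that rewriting sorts the indices.\<close>

definition inversions :: "(4 \<times> 4) set" where
  "inversions = {(2, 1), (3, 1), (4, 1), (3, 2), (4, 2), (4, 3)}"

lemma inversions_mem:
  "(2, 1) \<in> inversions" "(3, 1) \<in> inversions" "(4, 1) \<in> inversions"
  "(3, 2) \<in> inversions" "(4, 2) \<in> inversions" "(4, 3) \<in> inversions"
  by (simp_all add: inversions_def)

text \<open>One rule for each position of an adjacent pair among at most four indices.\<close>

lemma wedge_coeff_sort:
  assumes "(a, b) \<in> inversions"
  shows "wedge_coeff (a # b # I) J = - wedge_coeff (b # a # I) J"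
    "wedge_coeff (i # a # b # I) J = - wedge_coeff (i # b # a # I) J"
    "wedge_coeff (i # j # a # b # I) J = - wedge_coeff (i # j # b # a # I) J"
  using wedge_dx_swap[of "[]" a b I] wedge_dx_swap[of "[i]" a b I] wedge_dx_swap[of "[i, j]" a b I]
  by (simp_all add: wedge_coeff_def)

text \<open>Adjacent repetitions suffice, because sorting brings equal indices together; the same
  holds for \<open>levi_civita_repeat\<close>.\<close>

lemma wedge_coeff_repeat:
  "wedge_coeff (a # a # I) J = 0" "wedge_coeff (i # a # a # I) J = 0"
  "wedge_coeff (i # j # a # a # I) J = 0"
  using wedge_dx_repeat[of "[]" a I] wedge_dx_repeat[of "[i]" a I] wedge_dx_repeat[of "[i, j]" a I]
  by (simp_all add: wedge_coeff_def)

lemma levi_civita_sort: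
  "(j, i) \<in> inversions \<Longrightarrow> levi_civita j i k l = - levi_civita i j k l"
  "(k, j) \<in> inversions \<Longrightarrow> levi_civita i k j l = - levi_civita i j k l"
  "(l, k) \<in> inversions \<Longrightarrow> levi_civita i j l k = - levi_civita i j k l"
  by (rule levi_civita_swap)+

lemmas component_simps = component_ext_deriv dist_partial_zero dist_partial_minus
  increasing_indices_simps increasing_indices_mem sum_4
  wedge_coeff_increasing wedge_coeff_sort wedge_coeff_repeat
  levi_civita_sort levi_civita_repeat levi_civita_1234 inversions_mem

lemma proxy1_ext_deriv: "proxy1 (ext_deriv \<Omega> 0 \<phi>) = grad \<Omega> (proxy0 \<phi>)"
  by (simp add: proxy1_def grad_def proxy0_def vec_eq_iff forall_4 component_simps)

text \<open>For distinct i and j, the two orderings (k, l) of the complementary pair in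
  \<open>Curl\<close> give the two terms of the exterior derivative at that pair.\<close>

lemma proxy2_ext_deriv: "proxy2 (ext_deriv \<Omega> 1 \<phi>) = Curl \<Omega> (proxy1 \<phi>)"
  by (simp add: proxy2_def Curl_def proxy1_def vec_eq_iff forall_4 component_simps)

text \<open>The differentiation index m precedes I both in \<open>m # I\<close> and in the symbol
  with arguments i, m, I, so sorting produces the same sign on both sides.\<close>

lemma proxy3_ext_deriv: "proxy3 (ext_deriv \<Omega> 2 \<phi>) = Div \<Omega> (proxy2 \<phi>)"
  \<comment> \<open>Each entry has three terms, grouped by I on the left and by the differentiation
    index on the right; \<open>algebra_simps\<close> aligns them.\<close>
  by (simp add: proxy3_def Div_def proxy2_def vec_eq_iff forall_4 component_simps algebra_simps)

lemma proxy4_ext_deriv: "proxy4 (ext_deriv \<Omega> 3 \<phi>) = divergence \<Omega> (proxy3 \<phi>)"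
  by (simp add: proxy4_def divergence_def proxy3_def component_simps algebra_simps)

theorem proposition4p2:
  fixes \<Omega> :: "(real^4) set"
  assumes "open \<Omega>"
  shows "(\<forall>\<phi>\<in>form_distributions \<Omega> 0. proxy1 (ext_deriv \<Omega> 0 \<phi>) = grad \<Omega> (proxy0 \<phi>)) \<and>
    (\<forall>\<phi>\<in>form_distributions \<Omega> 1. proxy2 (ext_deriv \<Omega> 1 \<phi>) = Curl \<Omega> (proxy1 \<phi>)) \<and>
    (\<forall>\<phi>\<in>form_distributions \<Omega> 2. proxy3 (ext_deriv \<Omega> 2 \<phi>) = Div \<Omega> (proxy2 \<phi>)) \<and>
    (\<forall>\<phi>\<in>form_distributions \<Omega> 3. proxy4 (ext_deriv \<Omega> 3 \<phi>) = divergence \<Omega> (proxy3 \<phi>))"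
  by (intro conjI ballI proxy1_ext_deriv proxy2_ext_deriv proxy3_ext_deriv proxy4_ext_deriv)

end
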